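(* Let $\Phi$ be a QCTL formula, $\mathcal{K}=\langle V,E,\ell\rangle$ a Kripke structure with $V=\{x_0,\ldots,x_n\}$, $x\in V$, $\varepsilon:AP_Q^\Phi\to 2^V$ an environment (partial map) and $\varphi$ a subformula of $\Phi$. If $\widehat{\varphi}^{\,x,\mathrm{dom}(\varepsilon)}$ is the QBF formula defined inductively by the translation rules given in the context, then \[\mathcal{K},x\models_\varepsilon\varphi \quad\text{iff}\quad v_\varepsilon\models\widehat{\varphi}^{\,x,\mathrm{dom}(\varepsilon)}.\]
   Context: Kripke structure: $\langle V,E,\ell\rangle$ with $V$ finite, $E\subseteq V\times V$ such that every vertex has a successor, $\ell:V\to 2^{AP}$ for a finite set $AP$ of atomic propositions. QCTL formulas: $\varphi::= q\mid\neg\varphi\mid\varphi\vee\varphi\mid \mathsf{EX}\varphi\mid \mathsf{E}\varphi\mathsf{U}\varphi\mid\mathsf{A}\varphi\mathsf{U}\varphi\mid\exists p.\varphi$, with abbreviations $\wedge$, $\forall p=\neg\exists p\neg$, $\mathsf{AX}\varphi=\neg\mathsf{EX}\neg\varphi$, $\mathsf{EF}\varphi=\mathsf{E}\top\mathsf{U}\varphi$, $\mathsf{AG}\varphi=\neg\mathsf{EF}\neg\varphi$ (formulas may use $\wedge,\mathsf{AX},\mathsf{EF},\mathsf{AG}$ directly, translated by the dedicated rules below). Standard CTL semantics over infinite paths: $\mathsf{E}\varphi\mathsf{U}\psi$ (resp. $\mathsf{A}\varphi\mathsf{U}\psi$) holds at $x$ iff some (resp. every) infinite path from $x$ reaches a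 state satisfying $\psi$ with all earlier states satisfying $\varphi$. Standing assumption: every quantifier in $\Phi$ introduces a fresh atomic proposition, distinct from the propositions used in $\mathcal{K}$; $AP_Q^\Phi$ is the set of quantified propositions of $\Phi$. An environment is a partial map $\varepsilon:AP_Q^\Phi\to 2^V$. Semantics with environment: $\mathcal{K},x\models_\varepsilon p$ iff ($p\in AP_Q^\Phi$ and $x\in\varepsilon(p)$) or ($p\notin AP_Q^\Phi$ and $p\in\ell(x)$); $\mathcal{K},x\models_\varepsilon\exists p.\varphi$ iff there is $V'\subseteq V$ with $\mathcal{K},x\models_{\varepsilon[p\mapsto V']}\varphi$ (where $\varepsilon[p\mapsto V']$ agrees with $\varepsilon$ except it maps $p$ to $V'$); other operators as in CTL. QBF: formulas $\alpha::= q\mid\alpha\vee\alpha\mid\neg\alpha\mid\exists q.\alpha$ (with usual abbreviations), evaluated under Boolean valuations of free variables. The QBF variables are $p^{y}$ for $p\in AP_Q^\Phi$, $y\in V$. The valuation $v_\varepsilon$ sets $v_\varepsilon(p^y)=\top$ iff $y\in\varepsilon(p)$ (for $p\in\mathrm{dom}(\varepsilon)$). $E^*$ is the reflexive-transitive closure of $E$. Translation rules ($P\subseteq AP_Q^\Phi$): $\widehat{\neg\varphi}^{x,P}=\neg\widehat{\varphi}^{x,P}$; $\widehat{\varphi\vee\psi}^{x,P}=\widehat{\varphi}^{x,P}\vee\widehat{\psi}^{x,P}$; $\widehat{\varphi\wedge\psi}^{x,P}=\widehat{\varphi}^{x,P}\wedge\widehat{\psi}^{x,P}$; $\widehat{\exists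 p.\varphi}^{x,P}=\exists p^{x_0}\ldots\exists p^{x_n}.\widehat{\varphi}^{x,P\cup\{p\}}$; $\widehat{p}^{x,P}=p^x$ if $p\in P$, $\top$ if $p\notin P$ and $p\in\ell(x)$, $\bot$ otherwise; $\widehat{\mathsf{EX}\varphi}^{x,P}=\bigvee_{(x,x')\in E}\widehat{\varphi}^{x',P}$; $\widehat{\mathsf{AX}\varphi}^{x,P}=\bigwedge_{(x,x')\in E}\widehat{\varphi}^{x',P}$; $\widehat{\mathsf{EF}\varphi}^{x,P}=\bigvee_{(x,x')\in E^*}\widehat{\varphi}^{x',P}$; $\widehat{\mathsf{AG}\varphi}^{x,P}=\bigwedge_{(x,x')\in E^*}\widehat{\varphi}^{x',P}$; $\widehat{\mathsf{E}\varphi\mathsf{U}\psi}^{x,P}=\overline{\mathsf{E}\varphi\mathsf{U}\psi}^{x,P,\{x\}}$ where $\overline{\mathsf{E}\varphi\mathsf{U}\psi}^{x,P,X}=\widehat{\psi}^{x,P}\vee\big(\widehat{\varphi}^{x,P}\wedge\bigvee_{(x,x')\in E,\,x'\notin X}\overline{\mathsf{E}\varphi\mathsf{U}\psi}^{x',P,X\cup\{x'\}}\big)$; $\widehat{\mathsf{A}\varphi\mathsf{U}\psi}^{x,P}=\overline{\mathsf{A}\varphi\mathsf{U}\psi}^{x,P,\{x\}}$ where $\overline{\mathsf{A}\varphi\mathsf{U}\psi}^{x,P,X}=\widehat{\psi}^{x,P}$ if there is $(x,x')\in E$ with $x'\in X$, and otherwise $\widehat{\psi}^{x,P}\vee\big(\widehat{\varphi}^{x,P}\wedge\bigwedge_{(x,x')\in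 E}\overline{\mathsf{A}\varphi\mathsf{U}\psi}^{x',P,X\cup\{x'\}}\big)$. (Empty disjunction is $\bot$, empty conjunction $\top$.) *)

theory Defs
  imports Main
begin

record ('v, 'p) kripke =
  verts :: "'v set"
  edges :: "('v \<times> 'v) set"
  label :: "'v \<Rightarrow> 'p set"

definition kripke_structure :: "'p set \<Rightarrow> ('v, 'p) kripke \<Rightarrow> bool" where
  "kripke_structure AP K \<longleftrightarrow>
     finite AP \<and> finite (verts K) \<and>
     edges K \<subseteq> verts K \<times> verts K \<and>
     (\<forall>x\<in>verts K. \<exists>y. (x, y) \<in> edges K) \<and>
     (\<forall>x\<in>verts K. label K x \<subseteq> AP)"

definition path_from :: "('v, 'p) kripke \<Rightarrow> 'v \<Rightarrow> (nat \<Rightarrow> 'v) \<Rightarrow> bool" where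
  "path_from K x \<pi> \<longleftrightarrow> \<pi> 0 = x \<and> (\<forall>i. (\<pi> i, \<pi> (Suc i)) \<in> edges K)"


section \<open>QCTL\<close>

text \<open>
  The derived operators with a translation rule of their own (conjunction, AX, EF, AG) are
  constructors; their semantics is that of the formula they abbreviate.
\<close>

datatype 'p qctl =
    Prop 'p
  | Neg "'p qctl"
  | Or "'p qctl" "'p qctl"
  | And "'p qctl" "'p qctl"
  | ENext "'p qctl"
  | ANext "'p qctl"
  | EFinally "'p qctl"
  | AGlobally "'p qctl"
  | EUntil "'p qctl" "'p qctl"
  | AUntil "'p qctl" "'p qctl"
  | Exists 'p "'p qctl"

abbreviation Forall :: "'p \<Rightarrow> 'p qctl \<Rightarrow> 'p qctl" where
  "Forall p \<phi> \<equiv> Neg (Exists p (Neg \<phi>))"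

primrec subformulas :: "'p qctl \<Rightarrow> 'p qctl set" where
  "subformulas (Prop p) = {Prop p}"
| "subformulas (Neg \<phi>) = insert (Neg \<phi>) (subformulas \<phi>)"
| "subformulas (Or \<phi> \<psi>) = insert (Or \<phi> \<psi>) (subformulas \<phi> \<union> subformulas \<psi>)"
| "subformulas (And \<phi> \<psi>) = insert (And \<phi> \<psi>) (subformulas \<phi> \<union> subformulas \<psi>)"
| "subformulas (ENext \<phi>) = insert (ENext \<phi>) (subformulas \<phi>)"
| "subformulas (ANext \<phi>) = insert (ANext \<phi>) (subformulas \<phi>)"
| "subformulas (EFinally \<phi>) = insert (EFinally \<phi>) (subformulas \<phi>)"
| "subformulas (AGlobally \<phi>) = insert (AGlobally \<phi>) (subformulas \<phi>)"
| "subformulas (EUntil \<phi> \<psi>) = insert (EUntil \<phi> \<psi>) (subformulas \<phi> \<union> subformulas \<psi>)"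
| "subformulas (AUntil \<phi> \<psi>) = insert (AUntil \<phi> \<psi>) (subformulas \<phi> \<union> subformulas \<psi>)"
| "subformulas (Exists p \<phi>) = insert (Exists p \<phi>) (subformulas \<phi>)"

text \<open>The quantified propositions, one list entry per occurrence of a quantifier.\<close>

primrec quantifiers :: "'p qctl \<Rightarrow> 'p list" where
  "quantifiers (Prop p) = []"
| "quantifiers (Neg \<phi>) = quantifiers \<phi>"
| "quantifiers (Or \<phi> \<psi>) = quantifiers \<phi> @ quantifiers \<psi>"
| "quantifiers (And \<phi> \<psi>) = quantifiers \<phi> @ quantifiers \<psi>"
| "quantifiers (ENext \<phi>) = quantifiers \<phi>"
| "quantifiers (ANext \<phi>) = quantifiers \<phi>"
| "quantifiers (EFinally \<phi>) = quantifiers \<phi>"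
| "quantifiers (AGlobally \<phi>) = quantifiers \<phi>"
| "quantifiers (EUntil \<phi> \<psi>) = quantifiers \<phi> @ quantifiers \<psi>"
| "quantifiers (AUntil \<phi> \<psi>) = quantifiers \<phi> @ quantifiers \<psi>"
| "quantifiers (Exists p \<phi>) = p # quantifiers \<phi>"

definition AP_Q :: "'p qctl \<Rightarrow> 'p set" where
  "AP_Q \<Phi> = set (quantifiers \<Phi>)"

primrec free_props :: "'p qctl \<Rightarrow> 'p set" where
  "free_props (Prop p) = {p}"
| "free_props (Neg \<phi>) = free_props \<phi>"
| "free_props (Or \<phi> \<psi>) = free_props \<phi> \<union> free_props \<psi>"
| "free_props (And \<phi> \<psi>) = free_props \<phi> \<union> free_props \<psi>"
| "free_props (ENext \<phi>) = free_props \<phi>"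
| "free_props (ANext \<phi>) = free_props \<phi>"
| "free_props (EFinally \<phi>) = free_props \<phi>"
| "free_props (AGlobally \<phi>) = free_props \<phi>"
| "free_props (EUntil \<phi> \<psi>) = free_props \<phi> \<union> free_props \<psi>"
| "free_props (AUntil \<phi> \<psi>) = free_props \<phi> \<union> free_props \<psi>"
| "free_props (Exists p \<phi>) = free_props \<phi> - {p}"

definition fresh_quantifiers :: "('v, 'p) kripke \<Rightarrow> 'p qctl \<Rightarrow> bool" where
  "fresh_quantifiers K \<Phi> \<longleftrightarrow>
     distinct (quantifiers \<Phi>) \<and>
     AP_Q \<Phi> \<inter> free_props \<Phi> = {} \<and>
     (\<forall>x\<in>verts K. AP_Q \<Phi> \<inter> label K x = {})"

definition environment :: "('v, 'p) kripke \<Rightarrow> 'p set \<Rightarrow> ('p \<rightharpoonup> 'v set) \<Rightarrow> bool" where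
  "environment K Q \<epsilon> \<longleftrightarrow> dom \<epsilon> \<subseteq> Q \<and> (\<forall>S\<in>ran \<epsilon>. S \<subseteq> verts K)"

definition EX_sem :: "('v, 'p) kripke \<Rightarrow> ('v \<Rightarrow> bool) \<Rightarrow> 'v \<Rightarrow> bool" where
  "EX_sem K A x \<longleftrightarrow> (\<exists>y. (x, y) \<in> edges K \<and> A y)"

definition EU_sem :: "('v, 'p) kripke \<Rightarrow> ('v \<Rightarrow> bool) \<Rightarrow> ('v \<Rightarrow> bool) \<Rightarrow> 'v \<Rightarrow> bool" where
  "EU_sem K A B x \<longleftrightarrow> (\<exists>\<pi>. path_from K x \<pi> \<and> (\<exists>i. B (\<pi> i) \<and> (\<forall>j<i. A (\<pi> j))))"

definition AU_sem :: "('v, 'p) kripke \<Rightarrow> ('v \<Rightarrow> bool) \<Rightarrow> ('v \<Rightarrow> bool) \<Rightarrow> 'v \<Rightarrow> bool" where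
  "AU_sem K A B x \<longleftrightarrow> (\<forall>\<pi>. path_from K x \<pi> \<longrightarrow> (\<exists>i. B (\<pi> i) \<and> (\<forall>j<i. A (\<pi> j))))"

text \<open>
  The parameter \<open>Q\<close> is the set of quantified propositions of the ambient formula, of which the
  formula being evaluated is a subformula. A proposition of \<open>Q\<close> outside the domain of the
  environment holds nowhere.
\<close>

primrec sat :: "('v, 'p) kripke \<Rightarrow> 'p set \<Rightarrow> 'p qctl \<Rightarrow> ('p \<rightharpoonup> 'v set) \<Rightarrow> 'v \<Rightarrow> bool" where
  "sat K Q (Prop p) \<epsilon> x \<longleftrightarrow>
     (p \<in> Q \<and> (\<exists>S. \<epsilon> p = Some S \<and> x \<in> S)) \<or> (p \<notin> Q \<and> p \<in> label K x)"
| "sat K Q (Neg \<phi>) \<epsilon> x \<longleftrightarrow> \<not> sat K Q \<phi> \<epsilon> x"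
| "sat K Q (Or \<phi> \<psi>) \<epsilon> x \<longleftrightarrow> sat K Q \<phi> \<epsilon> x \<or> sat K Q \<psi> \<epsilon> x"
| "sat K Q (And \<phi> \<psi>) \<epsilon> x \<longleftrightarrow> sat K Q \<phi> \<epsilon> x \<and> sat K Q \<psi> \<epsilon> x"
| "sat K Q (ENext \<phi>) \<epsilon> x \<longleftrightarrow> EX_sem K (sat K Q \<phi> \<epsilon>) x"
| "sat K Q (ANext \<phi>) \<epsilon> x \<longleftrightarrow> \<not> EX_sem K (\<lambda>y. \<not> sat K Q \<phi> \<epsilon> y) x"
| "sat K Q (EFinally \<phi>) \<epsilon> x \<longleftrightarrow> EU_sem K (\<lambda>_. True) (sat K Q \<phi> \<epsilon>) x"
| "sat K Q (AGlobally \<phi>) \<epsilon> x \<longleftrightarrow> \<not> EU_sem K (\<lambda>_. True) (\<lambda>y. \<not> sat K Q \<phi> \<epsilon> y) x"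
| "sat K Q (EUntil \<phi> \<psi>) \<epsilon> x \<longleftrightarrow> EU_sem K (sat K Q \<phi> \<epsilon>) (sat K Q \<psi> \<epsilon>) x"
| "sat K Q (AUntil \<phi> \<psi>) \<epsilon> x \<longleftrightarrow> AU_sem K (sat K Q \<phi> \<epsilon>) (sat K Q \<psi> \<epsilon>) x"
| "sat K Q (Exists p \<phi>) \<epsilon> x \<longleftrightarrow> (\<exists>S. S \<subseteq> verts K \<and> sat K Q \<phi> (\<epsilon>(p \<mapsto> S)) x)"


section \<open>QBF\<close>

datatype 'q qbf =
    QVar 'q
  | QOr "'q qbf" "'q qbf"
  | QNeg "'q qbf"
  | QEx 'q "'q qbf"

text \<open>
  Valuations are partial maps on the variables. A variable outside the domain counts as false;
  this matters only when the domain does not contain all free variables of the formula.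
\<close>

primrec qbf_sat :: "('q \<rightharpoonup> bool) \<Rightarrow> 'q qbf \<Rightarrow> bool" where
  "qbf_sat v (QVar q) \<longleftrightarrow> v q = Some True"
| "qbf_sat v (QOr \<alpha> \<beta>) \<longleftrightarrow> qbf_sat v \<alpha> \<or> qbf_sat v \<beta>"
| "qbf_sat v (QNeg \<alpha>) \<longleftrightarrow> \<not> qbf_sat v \<alpha>"
| "qbf_sat v (QEx q \<alpha>) \<longleftrightarrow> (\<exists>b. qbf_sat (v(q \<mapsto> b)) \<alpha>)"

definition QAnd :: "'q qbf \<Rightarrow> 'q qbf \<Rightarrow> 'q qbf" where
  "QAnd \<alpha> \<beta> = QNeg (QOr (QNeg \<alpha>) (QNeg \<beta>))"

text \<open>
  The constants are abbreviations too. The bound variable is arbitrary; binding it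
  makes them closed formulas.
\<close>

definition QTrue :: "'q qbf" where
  "QTrue = (let q = undefined in QEx q (QOr (QVar q) (QNeg (QVar q))))"

definition QFalse :: "'q qbf" where
  "QFalse = QNeg QTrue"

definition QDisj :: "'q qbf list \<Rightarrow> 'q qbf" where
  "QDisj \<alpha>s = foldr QOr \<alpha>s QFalse"

definition QConj :: "'q qbf list \<Rightarrow> 'q qbf" where
  "QConj \<alpha>s = foldr QAnd \<alpha>s QTrue"

definition QExs :: "'q list \<Rightarrow> 'q qbf \<Rightarrow> 'q qbf" where
  "QExs qs \<alpha> = foldr QEx qs \<alpha>"


section \<open>Translation\<close>

text \<open>
  The pair \<open>(p, y)\<close> is the QBF variable \<open>p\<^sup>y\<close>. The list \<open>xs\<close> enumerates the vertices; it fixes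
  the order of the quantifier block and of the finite disjunctions and conjunctions.
\<close>

definition succs :: "('v, 'p) kripke \<Rightarrow> 'v list \<Rightarrow> 'v \<Rightarrow> 'v list" where
  "succs K xs x = filter (\<lambda>y. (x, y) \<in> edges K) xs"

definition reach :: "('v, 'p) kripke \<Rightarrow> 'v list \<Rightarrow> 'v \<Rightarrow> 'v list" where
  "reach K xs x = filter (\<lambda>y. (x, y) \<in> (edges K)\<^sup>*) xs"

function (sequential)
      hat :: "('v, 'p) kripke \<Rightarrow> 'v list \<Rightarrow> 'p qctl \<Rightarrow> 'v \<Rightarrow> 'p set \<Rightarrow> ('p \<times> 'v) qbf"
  and EU_bar :: "('v, 'p) kripke \<Rightarrow> 'v list \<Rightarrow> 'p qctl \<Rightarrow> 'p qctl \<Rightarrow> 'v \<Rightarrow> 'p set \<Rightarrow> 'v set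
        \<Rightarrow> ('p \<times> 'v) qbf"
  and AU_bar :: "('v, 'p) kripke \<Rightarrow> 'v list \<Rightarrow> 'p qctl \<Rightarrow> 'p qctl \<Rightarrow> 'v \<Rightarrow> 'p set \<Rightarrow> 'v set
        \<Rightarrow> ('p \<times> 'v) qbf"
where
  "hat K xs (Prop p) x P =
     (if p \<in> P then QVar (p, x) else if p \<in> label K x then QTrue else QFalse)"
| "hat K xs (Neg \<phi>) x P = QNeg (hat K xs \<phi> x P)"
| "hat K xs (Or \<phi> \<psi>) x P = QOr (hat K xs \<phi> x P) (hat K xs \<psi> x P)"
| "hat K xs (And \<phi> \<psi>) x P = QAnd (hat K xs \<phi> x P) (hat K xs \<psi> x P)"
| "hat K xs (ENext \<phi>) x P = QDisj (map (\<lambda>y. hat K xs \<phi> y P) (succs K xs x))"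
| "hat K xs (ANext \<phi>) x P = QConj (map (\<lambda>y. hat K xs \<phi> y P) (succs K xs x))"
| "hat K xs (EFinally \<phi>) x P = QDisj (map (\<lambda>y. hat K xs \<phi> y P) (reach K xs x))"
| "hat K xs (AGlobally \<phi>) x P = QConj (map (\<lambda>y. hat K xs \<phi> y P) (reach K xs x))"
| "hat K xs (EUntil \<phi> \<psi>) x P = EU_bar K xs \<phi> \<psi> x P {x}"
| "hat K xs (AUntil \<phi> \<psi>) x P = AU_bar K xs \<phi> \<psi> x P {x}"
| "hat K xs (Exists p \<phi>) x P = QExs (map (\<lambda>y. (p, y)) xs) (hat K xs \<phi> x (P \<union> {p}))"
| "EU_bar K xs \<phi> \<psi> x P X =
     QOr (hat K xs \<psi> x P)
       (QAnd (hat K xs \<phi> x P)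
         (QDisj (map (\<lambda>y. EU_bar K xs \<phi> \<psi> y P (X \<union> {y}))
           (filter (\<lambda>y. y \<notin> X) (succs K xs x)))))"
| "AU_bar K xs \<phi> \<psi> x P X =
     (if \<exists>y. (x, y) \<in> edges K \<and> y \<in> X then hat K xs \<psi> x P
      else
        QOr (hat K xs \<psi> x P)
          (QAnd (hat K xs \<phi> x P)
            (QConj (map (\<lambda>y. AU_bar K xs \<phi> \<psi> y P (X \<union> {y})) (succs K xs x)))))"
  by pat_completeness auto

lemma length_filter_notin_insert:
  assumes "y \<in> set xs" "y \<notin> X"
  shows "length (filter (\<lambda>z. z \<noteq> y \<and> z \<notin> X) xs) < length (filter (\<lambda>z. z \<notin> X) xs)"
proof -
  let ?ys = "filter (\<lambda>z. z \<notin> X) xs"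
  have "length (filter (\<lambda>z. z \<noteq> y) ?ys) < length ?ys"
    using assms by (intro length_filter_less[of y]) auto
  moreover have "filter (\<lambda>z. z \<noteq> y \<and> z \<notin> X) xs = filter (\<lambda>z. z \<noteq> y) ?ys"
    by (simp add: conj_commute)
  ultimately show ?thesis
    by simp
qed

termination
  by (relation "measures
        [\<lambda>t. case t of
            Inl (K, xs, \<phi>, x, P) \<Rightarrow> 2 * size \<phi>
          | Inr (Inl (K, xs, \<phi>, \<psi>, x, P, X)) \<Rightarrow> 2 * (size \<phi> + size \<psi>) + 1
          | Inr (Inr (K, xs, \<phi>, \<psi>, x, P, X)) \<Rightarrow> 2 * (size \<phi> + size \<psi>) + 1,
         \<lambda>t. case t of
            Inl _ \<Rightarrow> 0
          | Inr (Inl (K, xs, \<phi>, \<psi>, x, P, X)) \<Rightarrow> length (filter (\<lambda>z. z \<notin> X) xs)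
          | Inr (Inr (K, xs, \<phi>, \<psi>, x, P, X)) \<Rightarrow> length (filter (\<lambda>z. z \<notin> X) xs)]")
    (auto simp: succs_def intro!: length_filter_notin_insert)

definition env_valuation :: "('p \<rightharpoonup> 'v set) \<Rightarrow> ('p \<times> 'v \<rightharpoonup> bool)" where
  "env_valuation \<epsilon> = (\<lambda>(p, y). map_option (\<lambda>S. y \<in> S) (\<epsilon> p))"

end

theory Submission
  imports Defs
begin

text \<open>
  Both until operators are least fixpoints of monotone set operators \<open>F\<close>. The visited set \<open>X\<close> of
  the unfolded translation computes \<open>x \<in> F (\<mu>Z. F Z - X)\<close>: by the reduction lemma
  \<open>x \<in> \<mu>Z. F Z \<longleftrightarrow> x \<in> F (\<mu>Z. F Z - {x})\<close> (Kozen, Winskel), a state that is being unfolded may be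
  removed from the fixpoint, and once every state is removed the unfolding stops.
\<close>

section \<open>QBF\<close>

lemma qbf_sat_QAnd [simp]: "qbf_sat v (QAnd \<alpha> \<beta>) \<longleftrightarrow> qbf_sat v \<alpha> \<and> qbf_sat v \<beta>"
  by (simp add: QAnd_def)

lemma qbf_sat_QTrue [simp]: "qbf_sat v QTrue"
  by (simp add: QTrue_def Let_def)

lemma qbf_sat_QFalse [simp]: "\<not> qbf_sat v QFalse"
  by (simp add: QFalse_def)

lemma qbf_sat_QDisj [simp]: "qbf_sat v (QDisj \<alpha>s) \<longleftrightarrow> (\<exists>\<alpha>\<in>set \<alpha>s. qbf_sat v \<alpha>)"
  by (induction \<alpha>s) (simp_all add: QDisj_def)

lemma qbf_sat_QConj [simp]: "qbf_sat v (QConj \<alpha>s) \<longleftrightarrow> (\<forall>\<alpha>\<in>set \<alpha>s. qbf_sat v \<alpha>)"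
  by (induction \<alpha>s) (simp_all add: QConj_def)

text \<open>\<open>None\<close> and \<open>Some False\<close> act alike on a variable, so agreement
  on \<open>Some True\<close> is the right equivalence. It absorbs variables \<open>(p, y)\<close>
  with \<open>y\<close> outside \<open>xs\<close>: the quantifier block may leave them unassigned,
  while an updated environment assigns \<open>Some False\<close>.\<close>

lemma qbf_sat_cong:
  "(\<And>q. v q = Some True \<longleftrightarrow> w q = Some True) \<Longrightarrow> qbf_sat v \<alpha> \<longleftrightarrow> qbf_sat w \<alpha>"
proof (induction \<alpha> arbitrary: v w)
  case (QEx q \<alpha>)
  have "qbf_sat (v(q \<mapsto> b)) \<alpha> \<longleftrightarrow> qbf_sat (w(q \<mapsto> b)) \<alpha>" for b
    by (rule QEx.IH) (simp add: QEx.prems)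
  then show ?case
    by simp
next
  case (QOr \<alpha> \<beta>)
  from QOr.IH(1)[OF QOr.prems] QOr.IH(2)[OF QOr.prems] show ?case
    by simp
next
  case (QNeg \<alpha>)
  from QNeg.IH[OF QNeg.prems] show ?case
    by simp
qed simp

text \<open>Each binder contributes one value, and together the values form a choice function
  \<open>f\<close>. In this form the block can be matched with the choice of a single set.\<close>

lemma qbf_sat_QExs:
  "qbf_sat v (QExs qs \<alpha>) \<longleftrightarrow>
    (\<exists>f. qbf_sat (\<lambda>q. if q \<in> set qs then Some (f q) else v q) \<alpha>)"
proof (induction qs arbitrary: v)
  case Nil
  then show ?case
    by (simp add: QExs_def)
next
  case (Cons r qs)
  have "qbf_sat v (QExs (r # qs) \<alpha>) \<longleftrightarrow>
      (\<exists>b f. qbf_sat (\<lambda>q. if q \<in> set qs then Some (f q) else (v(r \<mapsto> b)) q) \<alpha>)"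
    using Cons.IH by (simp add: QExs_def)
  also have "\<dots> \<longleftrightarrow> (\<exists>f. qbf_sat (\<lambda>q. if q \<in> set (r # qs) then Some (f q) else v q) \<alpha>)"
    (is "?L \<longleftrightarrow> ?R")
  proof
    assume ?L
    then obtain b f
      where "qbf_sat (\<lambda>q. if q \<in> set qs then Some (f q) else (v(r \<mapsto> b)) q) \<alpha>"
      by blast
    \<comment> \<open>A variable may occur twice in the block. The inner binder then overrides the
      outer one, so \<open>b\<close> counts at \<open>r\<close> only if \<open>r\<close> is not in
      \<open>qs\<close>.\<close>
    moreover have "(\<lambda>q. if q \<in> set qs then Some (f q) else (v(r \<mapsto> b)) q) =
        (\<lambda>q. if q \<in> set (r # qs) then Some (if q \<in> set qs then f q else b) else v q)"
      by auto
    ultimately show ?R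
      by (intro exI[of _ "\<lambda>q. if q \<in> set qs then f q else b"]) simp
  next
    assume ?R
    then obtain f where "qbf_sat (\<lambda>q. if q \<in> set (r # qs) then Some (f q) else v q) \<alpha>"
      by blast
    moreover have "(\<lambda>q. if q \<in> set (r # qs) then Some (f q) else v q) =
        (\<lambda>q. if q \<in> set qs then Some (f q) else (v(r \<mapsto> f r)) q)"
      by auto
    ultimately show ?L
      by (intro exI[of _ "f r"] exI[of _ f]) simp
  qed
  finally show ?case .
qed

text \<open>Characteristic functions turn Boolean choices on the block into subsets of
  \<open>set xs\<close>. At \<open>(p, y)\<close> with \<open>y\<close> outside \<open>xs\<close>
  the old value survives; the assumption ensures that it is not \<open>Some True\<close>, in
  agreement with \<open>S\<close>.\<close>

lemma qbf_sat_QExs_env_valuation: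
  fixes \<epsilon> :: "'p \<rightharpoonup> 'v set"
  assumes "\<And>S. \<epsilon> p = Some S \<Longrightarrow> S \<subseteq> set xs"
  shows "qbf_sat (env_valuation \<epsilon>) (QExs (map (\<lambda>y. (p, y)) xs) \<alpha>) \<longleftrightarrow>
    (\<exists>S\<subseteq>set xs. qbf_sat (env_valuation (\<epsilon>(p \<mapsto> S))) \<alpha>)"
proof -
  define w where "w f = (\<lambda>q. if q \<in> set (map (\<lambda>y. (p, y)) xs) then Some (f q)
    else env_valuation \<epsilon> q)" for f
  have w: "qbf_sat (w f) \<alpha> \<longleftrightarrow> qbf_sat (env_valuation (\<epsilon>(p \<mapsto> S))) \<alpha>"
    if "\<And>y. y \<in> S \<longleftrightarrow> y \<in> set xs \<and> f (p, y)" for f S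
  proof (rule qbf_sat_cong)
    fix q :: "'p \<times> 'v"
    obtain a y where "q = (a, y)"
      by (cases q)
    then show "w f q = Some True \<longleftrightarrow> env_valuation (\<epsilon>(p \<mapsto> S)) q = Some True"
      using that[of y] assms by (cases "a = p"; cases "y \<in> set xs")
        (auto simp: w_def env_valuation_def)
  qed
  have "(\<exists>f. qbf_sat (w f) \<alpha>) \<longleftrightarrow>
      (\<exists>S\<subseteq>set xs. qbf_sat (env_valuation (\<epsilon>(p \<mapsto> S))) \<alpha>)" (is "?L \<longleftrightarrow> ?R")
  proof
    assume ?L
    then obtain f where "qbf_sat (w f) \<alpha>"
      by blast
    then have "qbf_sat (env_valuation (\<epsilon>(p \<mapsto> {y \<in> set xs. f (p, y)}))) \<alpha>"
      by (subst (asm) w[where S = "{y \<in> set xs. f (p, y)}"]) simp_all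
    then show ?R
      by (intro exI[of _ "{y \<in> set xs. f (p, y)}"]) simp
  next
    assume ?R
    then obtain S where S: "S \<subseteq> set xs" "qbf_sat (env_valuation (\<epsilon>(p \<mapsto> S))) \<alpha>"
      by blast
    have "y \<in> S \<longleftrightarrow> y \<in> set xs \<and> snd (p, y) \<in> S" for y
      using S(1) by auto
    with S(2) have "qbf_sat (w (\<lambda>q. snd q \<in> S)) \<alpha>"
      by (subst w[where S = S])
    then show ?L
      by (intro exI[of _ "\<lambda>q. snd q \<in> S"])
  qed
  then show ?thesis
    by (simp only: qbf_sat_QExs w_def)
qed

section \<open>Until operators as least fixpoints\<close>

text \<open>Sets over the whole type keep the operators simple. Outside \<open>verts K\<close> their
  fixpoints can differ from the path semantics, so the two are compared at vertices only.\<close>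

definition EU_step :: "('v, 'p) kripke \<Rightarrow> ('v \<Rightarrow> bool) \<Rightarrow> ('v \<Rightarrow> bool) \<Rightarrow> 'v set \<Rightarrow> 'v set" where
  "EU_step K A B Z = {x. B x \<or> A x \<and> (\<exists>y. (x, y) \<in> edges K \<and> y \<in> Z)}"

definition AU_step :: "('v, 'p) kripke \<Rightarrow> ('v \<Rightarrow> bool) \<Rightarrow> ('v \<Rightarrow> bool) \<Rightarrow> 'v set \<Rightarrow> 'v set" where
  "AU_step K A B Z = {x. B x \<or> A x \<and> (\<forall>y. (x, y) \<in> edges K \<longrightarrow> y \<in> Z)}"

lemma mono_EU_step: "mono (EU_step K A B)"
  unfolding EU_step_def mono_def by blast

lemma mono_AU_step: "mono (AU_step K A B)"
  unfolding AU_step_def mono_def by blast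

text \<open>An arbitrary \<open>f\<close> shows that paths exist; an \<open>f\<close> steered away
  from a fixpoint gives the counterexample path for \<open>AU_sem\<close>.\<close>

lemma path_fromI:
  assumes "kripke_structure AP K" "x \<in> verts K" "\<And>z. z \<in> verts K \<Longrightarrow> (z, f z) \<in> edges K"
  shows "path_from K x (\<lambda>i. (f ^^ i) x)"
proof -
  have "(f ^^ i) x \<in> verts K" for i
    using assms by (induction i) (auto simp: kripke_structure_def)
  then show ?thesis
    using assms(3) by (simp add: path_from_def)
qed

lemma path_from_exists:
  assumes "kripke_structure AP K" "x \<in> verts K"
  obtains \<pi> where "path_from K x \<pi>"
proof -
  obtain f where "\<And>z. z \<in> verts K \<Longrightarrow> (z, f z) \<in> edges K"
    using assms(1) unfolding kripke_structure_def by metis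
  from that path_fromI[OF assms this] show thesis
    by blast
qed

lemma path_from_Suc: "path_from K x \<pi> \<Longrightarrow> path_from K (\<pi> (Suc 0)) (\<lambda>i. \<pi> (Suc i))"
  by (simp add: path_from_def)

lemma path_from_case_nat:
  "path_from K y \<pi> \<Longrightarrow> (x, y) \<in> edges K \<Longrightarrow> path_from K x (case_nat x \<pi>)"
  by (auto simp: path_from_def split: nat.split)

text \<open>The semantics asks for an infinite path even when \<open>B\<close> holds at once. One
  exists because every vertex has a successor.\<close>

lemma EU_sem_base:
  assumes "kripke_structure AP K" "x \<in> verts K" "B x"
  shows "EU_sem K A B x"
proof -
  obtain \<pi> where "path_from K x \<pi>"
    using path_from_exists[OF assms(1,2)] .
  then show ?thesis
    using assms(3) unfolding EU_sem_def by (intro exI[of _ \<pi>] conjI exI[of _ 0])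
      (auto simp: path_from_def)
qed

lemma EU_sem_step:
  assumes "A x" "(x, y) \<in> edges K" "EU_sem K A B y"
  shows "EU_sem K A B x"
proof -
  obtain \<pi> i where "path_from K y \<pi>" "B (\<pi> i)" "\<And>j. j < i \<Longrightarrow> A (\<pi> j)"
    using assms(3) by (auto simp: EU_sem_def)
  then show ?thesis
    using assms(1,2) path_from_case_nat[of K y \<pi> x] unfolding EU_sem_def
    by (intro exI[of _ "case_nat x \<pi>"] conjI exI[of _ "Suc i"]) (auto split: nat.split)
qed

lemma EU_sem_iff_lfp:
  assumes "kripke_structure AP K" "x \<in> verts K"
  shows "EU_sem K A B x \<longleftrightarrow> x \<in> lfp (EU_step K A B)"
proof
  assume "EU_sem K A B x"
  then obtain \<pi> i where "path_from K x \<pi>" "B (\<pi> i)" "\<And>j. j < i \<Longrightarrow> A (\<pi> j)"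
    by (auto simp: EU_sem_def)
  then show "x \<in> lfp (EU_step K A B)"
  proof (induction i arbitrary: x \<pi>)
    case 0
    then show ?case
      by (subst lfp_unfold[OF mono_EU_step]) (auto simp: EU_step_def path_from_def)
  next
    case (Suc i)
    have "\<pi> (Suc 0) \<in> lfp (EU_step K A B)"
      using Suc.IH[OF path_from_Suc] Suc.prems by simp
    moreover have "A x" "(x, \<pi> (Suc 0)) \<in> edges K"
      using Suc.prems(3)[of 0] Suc.prems(1) by (auto simp: path_from_def)
    ultimately show ?case
      by (subst lfp_unfold[OF mono_EU_step]) (auto simp: EU_step_def)
  qed
next
  assume "x \<in> lfp (EU_step K A B)"
  \<comment> \<open>The fixpoint may contain points outside \<open>verts K\<close>, where no path
    starts, so the induction carries membership as a premise.\<close>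
  then have "x \<in> verts K \<longrightarrow> EU_sem K A B x"
  proof (induction rule: lfp_induct_set[OF _ mono_EU_step, consumes 1])
    case (1 z)
    then show ?case
      using assms(1) EU_sem_base[OF assms(1)] EU_sem_step[of A z]
      by (auto simp: EU_step_def kripke_structure_def)
  qed
  with assms(2) show "EU_sem K A B x"
    by blast
qed

lemma AU_sem_iff_lfp:
  assumes "kripke_structure AP K" "x \<in> verts K"
  shows "AU_sem K A B x \<longleftrightarrow> x \<in> lfp (AU_step K A B)"
proof
  assume "x \<in> lfp (AU_step K A B)"
  then show "AU_sem K A B x"
  proof (induction rule: lfp_induct_set[OF _ mono_AU_step, consumes 1])
    case (1 z)
    show ?case
      unfolding AU_sem_def
    proof (intro allI impI)
      fix \<pi>
      assume \<pi>: "path_from K z \<pi>"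
      show "\<exists>i. B (\<pi> i) \<and> (\<forall>j<i. A (\<pi> j))"
      proof (cases "B z")
        case True
        with \<pi> show ?thesis
          by (intro exI[of _ 0]) (simp add: path_from_def)
      next
        case False
        with 1 \<pi> have "A (\<pi> 0)" "AU_sem K A B (\<pi> (Suc 0))"
          by (auto simp: AU_step_def path_from_def)
        then obtain i where "B (\<pi> (Suc i))" "\<forall>j<i. A (\<pi> (Suc j))"
          using path_from_Suc[OF \<pi>] unfolding AU_sem_def by blast
        with \<open>A (\<pi> 0)\<close> show ?thesis
          by (intro exI[of _ "Suc i"]) (auto simp: less_Suc_eq_0_disj)
      qed
    qed
  qed
next
  assume AU: "AU_sem K A B x"
  show "x \<in> lfp (AU_step K A B)"
  proof (rule ccontr)
    let ?L = "lfp (AU_step K A B)"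
    assume "x \<notin> ?L"
    \<comment> \<open>Negating the fixpoint equation yields a move that stays outside the fixpoint
      wherever \<open>A\<close> holds.\<close>
    have out: "\<not> B z" "A z \<Longrightarrow> \<exists>y. (z, y) \<in> edges K \<and> y \<notin> ?L" if "z \<notin> ?L" for z
      using that lfp_unfold[OF mono_AU_step, of K A B] by (auto simp: AU_step_def)
    \<comment> \<open>Where no escaping move is promised, any successor serves. Thus
      \<open>f\<close> moves along an edge at every vertex, and its iterates form an infinite
      path.\<close>
    have "\<exists>y. (z, y) \<in> edges K \<and> (z \<notin> ?L \<longrightarrow> A z \<longrightarrow> y \<notin> ?L)" if "z \<in> verts K" for z
      using that assms(1) out(2)[of z] unfolding kripke_structure_def by blast
    then obtain f where f: "\<And>z. z \<in> verts K \<Longrightarrow> (z, f z) \<in> edges K"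
      "\<And>z. z \<in> verts K \<Longrightarrow> z \<notin> ?L \<Longrightarrow> A z \<Longrightarrow> f z \<notin> ?L"
      by metis
    have "path_from K x (\<lambda>i. (f ^^ i) x)"
      using path_fromI[OF assms f(1)] .
    with AU obtain i where i: "B ((f ^^ i) x)" "\<And>j. j < i \<Longrightarrow> A ((f ^^ j) x)"
      unfolding AU_sem_def by blast
    \<comment> \<open>Before position \<open>i\<close> the until property supplies \<open>A\<close>,
      so \<open>f\<close> keeps the path outside the fixpoint up to and including \<open>i\<close>,
      where \<open>B\<close> cannot hold.\<close>
    have "j \<le> i \<Longrightarrow> (f ^^ j) x \<in> verts K \<and> (f ^^ j) x \<notin> ?L" for j
    proof (induction j)
      case 0
      then show ?case
        using assms(2) \<open>x \<notin> ?L\<close> by simp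
    next
      case (Suc j)
      then show ?case
        using f[of "(f ^^ j) x"] i(2)[of j] assms(1) by (auto simp: kripke_structure_def)
    qed
    then show False
      using out(1) i(1) by blast
  qed
qed

text \<open>This serves EF and AG, which are translated through reachability and not by
  unfolding.\<close>

lemma EU_sem_True_iff_rtrancl:
  assumes "kripke_structure AP K" "x \<in> verts K"
  shows "EU_sem K (\<lambda>_. True) B x \<longleftrightarrow> (\<exists>y. (x, y) \<in> (edges K)\<^sup>* \<and> B y)"
proof
  assume "EU_sem K (\<lambda>_. True) B x"
  then obtain \<pi> i where \<pi>: "path_from K x \<pi>" "B (\<pi> i)"
    by (auto simp: EU_sem_def)
  have "(x, \<pi> j) \<in> (edges K)\<^sup>*" for j
    using \<pi>(1) by (induction j) (auto simp: path_from_def intro: rtrancl_into_rtrancl)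
  with \<pi>(2) show "\<exists>y. (x, y) \<in> (edges K)\<^sup>* \<and> B y"
    by blast
next
  assume "\<exists>y. (x, y) \<in> (edges K)\<^sup>* \<and> B y"
  then obtain y where "(x, y) \<in> (edges K)\<^sup>*" "B y"
    by blast
  from this assms(2) show "EU_sem K (\<lambda>_. True) B x"
  proof (induction rule: converse_rtrancl_induct)
    case base
    then show ?case
      using EU_sem_base[OF assms(1)] by blast
  next
    case (step u w)
    then show ?case
      using assms(1) EU_sem_step[of "\<lambda>_. True" u w] by (auto simp: kripke_structure_def)
  qed
qed

section \<open>The unfolded translation\<close>

text \<open>Write \<open>L\<close> for the fixpoint on the right. If \<open>x\<close> is not in
  \<open>F L\<close>, deleting \<open>x\<close> has no effect and \<open>F L = L\<close>; so
  \<open>L\<close> contains \<open>lfp F\<close>, although \<open>x\<close> is not in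
  \<open>L\<close>. The converse is monotonicity, as \<open>L\<close> lies below
  \<open>lfp F\<close>.\<close>

lemma lfp_reduction:
  fixes F :: "'a set \<Rightarrow> 'a set"
  assumes "mono F"
  shows "x \<in> lfp F \<longleftrightarrow> x \<in> F (lfp (\<lambda>Z. F Z - {x}))"
proof -
  let ?L = "lfp (\<lambda>Z. F Z - {x})"
  have "mono (\<lambda>Z. F Z - {x})"
    by (intro monoI Diff_mono monoD[OF assms] order_refl)
  then have L: "?L = F ?L - {x}"
    by (rule lfp_unfold)
  show ?thesis
  proof
    assume "x \<in> F ?L"
    moreover have "?L \<subseteq> lfp F"
      by (rule lfp_mono) blast
    then have "F ?L \<subseteq> F (lfp F)"
      by (rule monoD[OF assms])
    then have "F ?L \<subseteq> lfp F"
      by (simp only: lfp_unfold[OF assms, symmetric])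
    ultimately show "x \<in> lfp F"
      by blast
  next
    assume x: "x \<in> lfp F"
    show "x \<in> F ?L"
    proof (rule ccontr)
      assume "x \<notin> F ?L"
      with L have "F ?L \<subseteq> ?L"
        by blast
      then have "lfp F \<subseteq> ?L"
        by (rule lfp_lowerbound)
      with x L show False
        by blast
    qed
  qed
qed

text \<open>The reduction lemma for the operator that already deletes \<open>X\<close>. It mirrors
  one recursive call of the translation: \<open>y\<close> must be unvisited, and the evaluation goes
  on with \<open>y\<close> marked as visited.\<close>

lemma lfp_reduction_Diff:
  fixes F :: "'a set \<Rightarrow> 'a set"
  assumes "mono F"
  shows "y \<in> lfp (\<lambda>Z. F Z - X) \<longleftrightarrow> y \<notin> X \<and> y \<in> F (lfp (\<lambda>Z. F Z - insert y X))"
proof -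
  have "mono (\<lambda>Z. F Z - X)"
    by (intro monoI Diff_mono monoD[OF assms] order_refl)
  moreover have "(\<lambda>Z. F Z - X - {y}) = (\<lambda>Z. F Z - insert y X)"
    by blast
  ultimately show ?thesis
    using lfp_reduction[of "\<lambda>Z. F Z - X" y] by auto
qed

declare EU_bar.simps [simp del] AU_bar.simps [simp del]

text \<open>Each recursive call visits a new vertex, so the number of unvisited ones decreases. The
  outer step operator accounts for the current vertex, which in the calls made by the translation
  already lies in \<open>X\<close> and hence not in the fixpoint.\<close>

lemma qbf_sat_EU_bar:
  assumes E: "edges K \<subseteq> set xs \<times> set xs"
    and A: "\<And>y. y \<in> set xs \<Longrightarrow> qbf_sat v (hat K xs \<phi> y P) \<longleftrightarrow> A y"
    and B: "\<And>y. y \<in> set xs \<Longrightarrow> qbf_sat v (hat K xs \<psi> y P) \<longleftrightarrow> B y"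
    and "x \<in> set xs"
  shows "qbf_sat v (EU_bar K xs \<phi> \<psi> x P X) \<longleftrightarrow>
    x \<in> EU_step K A B (lfp (\<lambda>Z. EU_step K A B Z - X))"
  using \<open>x \<in> set xs\<close>
proof (induction "card (set xs - X)" arbitrary: x X rule: less_induct)
  case less
  let ?F = "EU_step K A B"
  have IH: "qbf_sat v (EU_bar K xs \<phi> \<psi> y P (insert y X)) \<longleftrightarrow>
      y \<in> ?F (lfp (\<lambda>Z. ?F Z - insert y X))" if "y \<in> set xs" "y \<notin> X" for y
    using that by (intro less.hyps psubset_card_mono) auto
  have "qbf_sat v (EU_bar K xs \<phi> \<psi> x P X) \<longleftrightarrow> B x \<or> A x \<and>
      (\<exists>y. (x, y) \<in> edges K \<and> y \<notin> X \<and> y \<in> ?F (lfp (\<lambda>Z. ?F Z - insert y X)))"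
    using E IH less.prems by (subst EU_bar.simps) (auto simp: A B succs_def)
  also have "\<dots> \<longleftrightarrow> x \<in> ?F (lfp (\<lambda>Z. ?F Z - X))"
    \<comment> \<open>Only the outer operator is unfolded. With \<open>X\<close> fixed, the
      reduction rule cannot apply again to the fixpoint for \<open>insert y X\<close> that it
      produces.\<close>
    by (simp add: EU_step_def[of _ _ _ "lfp _"]
        lfp_reduction_Diff[OF mono_EU_step, where X = X])
  finally show ?case .
qed

lemma qbf_sat_AU_bar:
  assumes E: "edges K \<subseteq> set xs \<times> set xs"
    and A: "\<And>y. y \<in> set xs \<Longrightarrow> qbf_sat v (hat K xs \<phi> y P) \<longleftrightarrow> A y"
    and B: "\<And>y. y \<in> set xs \<Longrightarrow> qbf_sat v (hat K xs \<psi> y P) \<longleftrightarrow> B y"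
    and "x \<in> set xs"
  shows "qbf_sat v (AU_bar K xs \<phi> \<psi> x P X) \<longleftrightarrow>
    x \<in> AU_step K A B (lfp (\<lambda>Z. AU_step K A B Z - X))"
  using \<open>x \<in> set xs\<close>
proof (induction "card (set xs - X)" arbitrary: x X rule: less_induct)
  case less
  let ?F = "AU_step K A B"
  have IH: "qbf_sat v (AU_bar K xs \<phi> \<psi> y P (insert y X)) \<longleftrightarrow>
      y \<in> ?F (lfp (\<lambda>Z. ?F Z - insert y X))" if "y \<in> set xs" "y \<notin> X" for y
    using that by (intro less.hyps psubset_card_mono) auto
  \<comment> \<open>Both branches of the translation meet here: a visited successor falsifies the
    universal conjunct and leaves only \<open>B x\<close>; otherwise \<open>y \<notin> X\<close>
    holds for every successor.\<close>
  have "qbf_sat v (AU_bar K xs \<phi> \<psi> x P X) \<longleftrightarrow> B x \<or> A x \<and>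
      (\<forall>y. (x, y) \<in> edges K \<longrightarrow> y \<notin> X \<and> y \<in> ?F (lfp (\<lambda>Z. ?F Z - insert y X)))"
    using E IH less.prems by (subst AU_bar.simps) (auto simp: A B succs_def)
  also have "\<dots> \<longleftrightarrow> x \<in> ?F (lfp (\<lambda>Z. ?F Z - X))"
    by (simp add: AU_step_def[of _ _ _ "lfp _"]
        lfp_reduction_Diff[OF mono_AU_step, where X = X])
  finally show ?case .
qed

section \<open>Induction on the formula\<close>

lemma quantifiers_subformulas:
  "\<phi> \<in> subformulas \<Phi> \<Longrightarrow> set (quantifiers \<phi>) \<subseteq> set (quantifiers \<Phi>)"
  by (induction \<Phi>) auto

lemma rtrancl_edges_in_verts:
  assumes "kripke_structure AP K" "x \<in> verts K" "(x, y) \<in> (edges K)\<^sup>*"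
  shows "y \<in> verts K"
  using assms(3,2,1) by (induction rule: rtrancl_induct) (auto simp: kripke_structure_def)

text \<open>\<open>Q\<close> stays fixed while the formula shrinks, because the meaning of a
  proposition depends on the quantifiers of the ambient formula. The environment varies, since
  quantifiers extend it.\<close>

lemma sat_iff_qbf_sat_hat:
  assumes K: "kripke_structure AP K"
    and Q: "\<And>x. x \<in> verts K \<Longrightarrow> Q \<inter> label K x = {}"
    and xs: "verts K = set xs"
    and "x \<in> verts K" "environment K Q \<epsilon>" "set (quantifiers \<phi>) \<subseteq> Q"
  shows "sat K Q \<phi> \<epsilon> x \<longleftrightarrow> qbf_sat (env_valuation \<epsilon>) (hat K xs \<phi> x (dom \<epsilon>))"
proof -
  have E: "edges K \<subseteq> set xs \<times> set xs"
    using K xs by (simp add: kripke_structure_def)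
  from assms(4-) show ?thesis
  proof (induction \<phi> arbitrary: \<epsilon> x)
    \<comment> \<open>The delicate case is \<open>p\<close> in \<open>Q\<close> without a value:
      semantically it is false, while the translation consults the label, which is disjoint from
      \<open>Q\<close>.\<close>
    case (Prop p)
    then show ?case
      using Q[of x] by (auto simp: environment_def env_valuation_def)
  next
    case (ENext \<phi>)
    have "sat K Q \<phi> \<epsilon> y \<longleftrightarrow> qbf_sat (env_valuation \<epsilon>) (hat K xs \<phi> y (dom \<epsilon>))"
      if "(x, y) \<in> edges K" for y
      using E ENext xs that by auto
    then show ?case
      using E by (auto simp: EX_sem_def succs_def)
  next
    case (ANext \<phi>)
    have "sat K Q \<phi> \<epsilon> y \<longleftrightarrow> qbf_sat (env_valuation \<epsilon>) (hat K xs \<phi> y (dom \<epsilon>))"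
      if "(x, y) \<in> edges K" for y
      using E ANext xs that by auto
    then show ?case
      using E by (auto simp: EX_sem_def succs_def)
  next
    case (EFinally \<phi>)
    have "y \<in> set xs \<and>
        (sat K Q \<phi> \<epsilon> y \<longleftrightarrow> qbf_sat (env_valuation \<epsilon>) (hat K xs \<phi> y (dom \<epsilon>)))"
      if "(x, y) \<in> (edges K)\<^sup>*" for y
      using EFinally xs that rtrancl_edges_in_verts[OF K, of x y] by auto
    then show ?case
      using EFinally.prems(1) by (auto simp: EU_sem_True_iff_rtrancl[OF K] reach_def)
  next
    case (AGlobally \<phi>)
    have "y \<in> set xs \<and>
        (sat K Q \<phi> \<epsilon> y \<longleftrightarrow> qbf_sat (env_valuation \<epsilon>) (hat K xs \<phi> y (dom \<epsilon>)))"
      if "(x, y) \<in> (edges K)\<^sup>*" for y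
      using AGlobally xs that rtrancl_edges_in_verts[OF K, of x y] by auto
    then show ?case
      using AGlobally.prems(1) by (auto simp: EU_sem_True_iff_rtrancl[OF K] reach_def)
  next
    case (EUntil \<phi> \<psi>)
    let ?A = "sat K Q \<phi> \<epsilon>" and ?B = "sat K Q \<psi> \<epsilon>"
    have "qbf_sat (env_valuation \<epsilon>) (EU_bar K xs \<phi> \<psi> x (dom \<epsilon>) {x}) \<longleftrightarrow>
        x \<in> EU_step K ?A ?B (lfp (\<lambda>Z. EU_step K ?A ?B Z - {x}))"
      using E EUntil xs by (intro qbf_sat_EU_bar) auto
    \<comment> \<open>The initial visited set \<open>{x}\<close> is exactly the situation of the
      reduction lemma, read from right to left.\<close>
    also have "\<dots> \<longleftrightarrow> EU_sem K ?A ?B x"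
      using EUntil.prems(1)
      by (simp only: lfp_reduction[OF mono_EU_step, symmetric] EU_sem_iff_lfp[OF K])
    finally show ?case
      by simp
  next
    case (AUntil \<phi> \<psi>)
    let ?A = "sat K Q \<phi> \<epsilon>" and ?B = "sat K Q \<psi> \<epsilon>"
    have "qbf_sat (env_valuation \<epsilon>) (AU_bar K xs \<phi> \<psi> x (dom \<epsilon>) {x}) \<longleftrightarrow>
        x \<in> AU_step K ?A ?B (lfp (\<lambda>Z. AU_step K ?A ?B Z - {x}))"
      using E AUntil xs by (intro qbf_sat_AU_bar) auto
    also have "\<dots> \<longleftrightarrow> AU_sem K ?A ?B x"
      using AUntil.prems(1)
      by (simp only: lfp_reduction[OF mono_AU_step, symmetric] AU_sem_iff_lfp[OF K])
    finally show ?case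
      by simp
  next
    case (Exists p \<phi>)
    have \<epsilon>: "\<epsilon> p = Some S \<Longrightarrow> S \<subseteq> set xs" for S
      using Exists.prems(2) xs by (auto simp: environment_def ran_def)
    have "sat K Q \<phi> (\<epsilon>(p \<mapsto> S)) x \<longleftrightarrow>
        qbf_sat (env_valuation (\<epsilon>(p \<mapsto> S))) (hat K xs \<phi> x (insert p (dom \<epsilon>)))"
      if "S \<subseteq> set xs" for S
    proof -
      \<comment> \<open>The updated environment is again admissible, as \<open>p\<close> is a
        quantifier in \<open>Q\<close> and \<open>S\<close> consists of vertices. Its domain is the
        enlarged set of propositions in the translation rule.\<close>
      define \<delta> where "\<delta> = \<epsilon>(p \<mapsto> S)"
      have "environment K Q \<delta>" "dom \<delta> = insert p (dom \<epsilon>)"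
        using Exists.prems(2,3) that xs by (auto simp: \<delta>_def environment_def ran_def)
      with Exists.IH[of x \<delta>] Exists.prems(1,3) show ?thesis
        by (simp flip: \<delta>_def)
    qed
    then show ?case
      using xs by (auto simp: qbf_sat_QExs_env_valuation[where \<epsilon> = \<epsilon>, OF \<epsilon>])
  qed simp_all
qed

theorem theorem1:
  fixes K :: "('v, 'p) kripke"
    and AP :: "'p set"
    and \<Phi> \<phi> :: "'p qctl"
    and xs :: "'v list"
    and x :: 'v
    and \<epsilon> :: "'p \<rightharpoonup> 'v set"
  assumes "kripke_structure AP K"
    and "fresh_quantifiers K \<Phi>"
    and "verts K = set xs" and "distinct xs"
    and "x \<in> verts K"
    and "environment K (AP_Q \<Phi>) \<epsilon>"
    and "\<phi> \<in> subformulas \<Phi>"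
  shows "sat K (AP_Q \<Phi>) \<phi> \<epsilon> x \<longleftrightarrow> qbf_sat (env_valuation \<epsilon>) (hat K xs \<phi> x (dom \<epsilon>))"
  using assms quantifiers_subformulas[OF assms(7)]
  by (intro sat_iff_qbf_sat_hat) (auto simp: fresh_quantifiers_def AP_Q_def)

end
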